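(* In the setting $\text{EZF}^*$ with $\neg CH$-cardinality described in the context, let $Z$ be a Zermelo set such that $|Z|_{\neg ch}<|P(Z')|_{\neg ch}$, where $Z'$ is a non-powered Zermelo set. Then for every integer $n\ge1$, $|Z|_{\neg ch}<|Z\cup P^{-n}(Z')|_{\neg ch}$ and $|Z\cup P^{-n}(Z')|_{\neg ch}<|P(Z)|_{\neg ch}$.
   Context: Zermelo sets are the members of the von Neumann universe $\mathcal V$ (the ZF sets); $|X|$ is classical cardinality, $P(X)$ the power set. A Zermelo set is powered if it equals $P(X')$ for some Zermelo set $X'$, otherwise non-powered. The theory is extended by new membership relations $\in_n$ ($n\ge1$, $\in_0=\in$) and inverse powerset objects: for a Zermelo set $Y$, $P^{-1}(Y)$ is an object whose $\in_1$-members are exactly the elements of $Y$, and iterating, $P^{-n}(Y)$ ($n$-fold) has $\in_{n}$-members described correspondingly; for non-powered Zermelo $Y$ and $n\ge1$, $P^{-n}(Y)$ is called a non-Zermelo set of level $n$, and $P^{-1}(P(X))=X$. Finite union forms $A_1\cup\dots\cup A_n$ of such objects exist (union being commutative and associative, and the union of Zermelo sets being the classical union). $\text{EZF}^*$ consists of Zermelo sets, non-Zermelo sets of any level, and finite union forms of these; every element can be written $X_1\cup X_2\cup\dots\cup X_n$ with $X_1$ Zermelo (possibly empty) and $X_2,\dots,X_n$ non-Zermelo sets. Functions on components: $\rho(Y)=0$ for a Zermelo set $Y\neq\emptyset$, $\rho(P^{-m}(Y))=-m$ for non-powered Zermelo $Y$, $\rho(\emptyset)=-\infty$; $\tau(Y)=|Y|$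 for Zermelo $Y$ and $\tau(P^{-m}(Y))=|Y|$. A union $X_1\cup\dots\cup X_n$ is well-represented iff $\rho(X_1)\ge\dots\ge\rho(X_n)$ and, whenever $\rho(X_i)=\dots=\rho(X_{i+k})$, $\tau(X_i)\ge\dots\ge\tau(X_{i+k})$. $\neg CH$-cardinality: for $X=X_1\cup\dots\cup X_n$ and $Y=Y_1\cup\dots\cup Y_m$ in $\text{EZF}^*$ where only $X_1,Y_1$ are Zermelo (possibly empty), $X_2,\dots,X_n,Y_2,\dots,Y_m$ are non-empty non-Zermelo, and $X_2\cup\dots\cup X_n$, $Y_2\cup\dots\cup Y_m$ are well-represented: $|X|_{\neg ch}\le|Y|_{\neg ch}$ iff either $|X_1|<|Y_1|$, or simultaneously $|X_1|=|Y_1|$, $n\le m$, and $\rho(X_i)\le\rho(Y_i)$, $\tau(X_i)\le\tau(Y_i)$ for all $2\le i\le n$. Equality $|X|_{\neg ch}=|Y|_{\neg ch}$ holds iff $|X_1|=|Y_1|$, $n=m$, and $\rho(X_i)=\rho(Y_i)$, $\tau(X_i)=\tau(Y_i)$ for all $i$. Strict $<$ means $\le$ and not equal. *)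

theory Defs
  imports "HOL-Library.Extended_Real" "HOL-Library.Multiset"
begin

unbundle cardinal_syntax

section \<open>Zermelo sets\<close>

text \<open>
  A type of class \<open>zf\<close> is a universe of ZF sets. Replacement is the second-order axiom (it ranges
  over all HOL relations), so an injection or bijection between two sets of the universe exists
  in HOL iff its graph is a set of the universe. Hence the cardinality of a set may be taken to be
  the HOL cardinality of its extension. Separation, the empty set and choice follow.
\<close>

class zf =
  fixes mem :: "'a \<Rightarrow> 'a \<Rightarrow> bool"
  assumes extensionality: "(\<And>w. mem w x \<longleftrightarrow> mem w y) \<Longrightarrow> x = y"
    and foundation: "mem w x \<Longrightarrow> \<exists>y. mem y x \<and> \<not> (\<exists>z. mem z x \<and> mem z y)"
    and pairing: "\<exists>p. \<forall>w. mem w p \<longleftrightarrow> w = x \<or> w = y"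
    and union: "\<exists>u. \<forall>w. mem w u \<longleftrightarrow> (\<exists>y. mem y x \<and> mem w y)"
    and powerset: "\<exists>p. \<forall>s. mem s p \<longleftrightarrow> (\<forall>w. mem w s \<longrightarrow> mem w x)"
    and infinity: "\<exists>i. (\<exists>e. mem e i \<and> (\<forall>w. \<not> mem w e)) \<and>
          (\<forall>x. mem x i \<longrightarrow> (\<exists>s. mem s i \<and> (\<forall>w. mem w s \<longleftrightarrow> mem w x \<or> w = x)))"
    and replacement: "(\<And>x y y'. mem x a \<Longrightarrow> R x y \<Longrightarrow> R x y' \<Longrightarrow> y = y') \<Longrightarrow>
          \<exists>b. \<forall>y. mem y b \<longleftrightarrow> (\<exists>x. mem x a \<and> R x y)"

definition elts :: "'v::zf \<Rightarrow> 'v set" where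
  "elts X = {x. mem x X}"

definition zempty :: "'v::zf" where
  "zempty = (THE E. elts E = {})"

definition zun :: "'v::zf \<Rightarrow> 'v \<Rightarrow> 'v" where
  "zun X Y = (THE U. elts U = elts X \<union> elts Y)"

definition zpow :: "'v::zf \<Rightarrow> 'v" where
  "zpow X = (THE S. elts S = {s. elts s \<subseteq> elts X})"

definition powered :: "'v::zf \<Rightarrow> bool" where
  "powered Y \<longleftrightarrow> (\<exists>X. Y = zpow X)"

lemma elts_inject: "elts X = elts Y \<longleftrightarrow> X = (Y::'v::zf)"
  using extensionality[of X Y] by (auto simp: elts_def set_eq_iff)

lemma elts_the:
  assumes "\<exists>b::'v::zf. elts b = A"
  shows "elts (THE b. elts b = A) = A"
proof -
  have "\<exists>!b::'v. elts b = A"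
    using assms elts_inject by blast
  then show ?thesis by (rule theI')
qed

lemma elts_zempty [simp]: "elts (zempty::'v::zf) = {}"
proof -
  obtain e :: 'v where "\<forall>w. \<not> mem w e"
    using infinity by blast
  then show ?thesis
    unfolding zempty_def by (intro elts_the) (auto simp: elts_def)
qed

lemma elts_zun [simp]: "elts (zun X Y) = elts X \<union> elts (Y::'v::zf)"
proof -
  obtain p where p: "\<forall>w. mem w p \<longleftrightarrow> w = X \<or> w = Y"
    using pairing by blast
  obtain u where "\<forall>w. mem w u \<longleftrightarrow> (\<exists>y. mem y p \<and> mem w y)"
    using union by blast
  with p have "elts u = elts X \<union> elts Y"
    by (auto simp: elts_def)
  then show ?thesis
    unfolding zun_def by (intro elts_the) auto
qed

lemma elts_zpow [simp]: "elts (zpow X) = {s. elts s \<subseteq> elts (X::'v::zf)}"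
proof -
  obtain p where "\<forall>s. mem s p \<longleftrightarrow> (\<forall>w. mem w s \<longrightarrow> mem w X)"
    using powerset by blast
  then have "elts p = {s. elts s \<subseteq> elts X}"
    by (auto simp: elts_def)
  then show ?thesis
    unfolding zpow_def by (intro elts_the) auto
qed

lemma zpow_inject [simp]: "zpow X = zpow Y \<longleftrightarrow> X = (Y::'v::zf)"
proof
  assume "zpow X = zpow Y"
  then have "{s. elts s \<subseteq> elts X} = {s. elts s \<subseteq> elts Y}"
    by (metis elts_zpow)
  then have "elts X = elts Y" by blast
  then show "X = Y" by (simp add: elts_inject)
qed simp

lemma not_powered_zempty: "\<not> powered (zempty::'v::zf)"
proof
  assume "powered (zempty::'v)"
  then obtain X :: 'v where "zempty = zpow X" by (auto simp: powered_def)
  then have "elts (zpow X) = {}" by (metis elts_zempty)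
  then show False by auto
qed


section \<open>Inverse powerset objects\<close>

text \<open>
  \<open>NonZermelo m Y\<close> stands for the object P^{-m}(Y); it is only meaningful for \<open>m \<ge> 1\<close> and \<open>Y\<close>
  non-powered, and only such values are produced by \<open>inv_pow\<close>.
\<close>

datatype 'v component = Zermelo 'v | NonZermelo nat 'v

fun inv_pow1 :: "'v::zf component \<Rightarrow> 'v component" where
  "inv_pow1 (Zermelo Y) = (if powered Y then Zermelo (THE X. Y = zpow X) else NonZermelo 1 Y)"
| "inv_pow1 (NonZermelo m Y) = NonZermelo (Suc m) Y"

definition inv_pow :: "nat \<Rightarrow> 'v::zf \<Rightarrow> 'v component" where
  "inv_pow n Y = (inv_pow1 ^^ n) (Zermelo Y)"

definition is_zermelo :: "'v::zf component \<Rightarrow> bool" where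
  "is_zermelo C \<longleftrightarrow> (\<exists>X. C = Zermelo X)"

definition is_nonzermelo :: "'v::zf component \<Rightarrow> bool" where
  "is_nonzermelo C \<longleftrightarrow> (\<exists>m Y. m \<ge> 1 \<and> \<not> powered Y \<and> C = inv_pow m Y)"

text \<open>The membership relation of index \<open>n\<close>, on the objects P^{-n}(Y).\<close>

definition mem_level :: "nat \<Rightarrow> 'v::zf \<Rightarrow> 'v component \<Rightarrow> bool" where
  "mem_level n x C \<longleftrightarrow> (\<exists>Y. C = inv_pow n Y \<and> mem x Y)"

lemma inv_pow1_zpow: "inv_pow1 (Zermelo (zpow X)) = Zermelo X"
  by (auto simp: powered_def)

lemma inv_pow_0: "inv_pow 0 Y = Zermelo Y"
  by (simp add: inv_pow_def)

lemma inv_pow_nonpowered: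
  assumes "\<not> powered Y" "m \<ge> 1"
  shows "inv_pow m Y = NonZermelo m Y"
  using assms(2) by (induction m rule: dec_induct) (simp_all add: inv_pow_def assms(1))

lemma inv_pow_wf:
  "inv_pow n Y = NonZermelo m W \<Longrightarrow> m \<ge> 1 \<and> \<not> powered W"
proof (induction n arbitrary: m W)
  case (Suc n)
  then show ?case
    by (cases "inv_pow n Y") (auto simp: inv_pow_def split: if_splits)
qed (simp add: inv_pow_def)

lemma inv_pow_inject: "inv_pow n Y = inv_pow n Y' \<longleftrightarrow> Y = Y'"
proof
  show "inv_pow n Y = inv_pow n Y' \<Longrightarrow> Y = Y'"
  proof (induction n)
    case (Suc n)
    have "inv_pow1 (inv_pow n Y) = inv_pow1 (inv_pow n Y')"
      using Suc.prems by (simp add: inv_pow_def)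
    then have "inv_pow n Y = inv_pow n Y'"
      using inv_pow_wf[of n Y] inv_pow_wf[of n Y']
      by (cases "inv_pow n Y"; cases "inv_pow n Y'")
         (auto simp: powered_def split: if_splits)
    then show ?case by (rule Suc.IH)
  qed (simp add: inv_pow_def)
qed simp

lemma mem_level_0: "mem_level 0 x (Zermelo Y) \<longleftrightarrow> mem x Y"
  by (simp add: mem_level_def inv_pow_0)

lemma mem_level_inv_pow: "mem_level n x (inv_pow n Y) \<longleftrightarrow> mem x Y"
  by (auto simp: mem_level_def inv_pow_inject)

lemma is_nonzermelo_iff:
  "is_nonzermelo C \<longleftrightarrow> (\<exists>m Y. m \<ge> 1 \<and> \<not> powered Y \<and> C = NonZermelo m Y)"
  by (auto simp: is_nonzermelo_def inv_pow_nonpowered) (metis inv_pow_nonpowered One_nat_def)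


section \<open>Union forms\<close>

text \<open>
  Modulo commutativity, associativity, the union of Zermelo sets being the classical one, and the
  empty set being neutral, a union form is one Zermelo set (possibly empty) together with a finite
  multiset of non-Zermelo sets.
\<close>

datatype 'v union_form = Union_Form 'v "'v component multiset"

fun single :: "'v::zf component \<Rightarrow> 'v union_form" where
  "single (Zermelo X) = Union_Form X {#}"
| "single (NonZermelo m Y) = Union_Form zempty {#NonZermelo m Y#}"

fun ezf_union :: "'v::zf union_form \<Rightarrow> 'v union_form \<Rightarrow> 'v union_form" (infixl "\<squnion>\<^sub>E" 65) where
  "Union_Form X M \<squnion>\<^sub>E Union_Form Y N = Union_Form (zun X Y) (M + N)"

inductive_set EZF_star :: "'v::zf union_form set" where
  zermelo: "is_zermelo C \<Longrightarrow> single C \<in> EZF_star"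
| nonzermelo: "is_nonzermelo C \<Longrightarrow> single C \<in> EZF_star"
| union: "X \<in> EZF_star \<Longrightarrow> Y \<in> EZF_star \<Longrightarrow> X \<squnion>\<^sub>E Y \<in> EZF_star"

definition Union_list :: "'v::zf component list \<Rightarrow> 'v union_form" where
  "Union_list Cs = foldr (\<lambda>C X. single C \<squnion>\<^sub>E X) Cs (single (Zermelo zempty))"

lemma zun_commute: "zun X Y = zun Y (X::'v::zf)"
  by (simp add: Un_commute flip: elts_inject)

lemma zun_assoc: "zun (zun X Y) W = zun X (zun Y (W::'v::zf))"
  by (simp add: Un_assoc flip: elts_inject)

lemma zun_zempty [simp]: "zun X zempty = X" "zun zempty X = (X::'v::zf)"
  by (simp_all flip: elts_inject)

lemma ezf_union_commute: "X \<squnion>\<^sub>E Y = Y \<squnion>\<^sub>E X"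
  by (cases X; cases Y) (simp add: zun_commute add.commute)

lemma ezf_union_assoc: "(X \<squnion>\<^sub>E Y) \<squnion>\<^sub>E W = X \<squnion>\<^sub>E (Y \<squnion>\<^sub>E W)"
  by (cases X; cases Y; cases W) (simp add: zun_assoc add.assoc)

lemma ezf_union_zermelo: "single (Zermelo X) \<squnion>\<^sub>E single (Zermelo Y) = single (Zermelo (zun X Y))"
  by simp


section \<open>The cardinality\<close>

fun rho :: "'v::zf component \<Rightarrow> ereal" where
  "rho (Zermelo Y) = (if Y = zempty then -\<infinity> else 0)"
| "rho (NonZermelo m Y) = - ereal (real m)"

text \<open>
  The values of \<open>tau\<close> are cardinals, to be compared by \<open>\<le>o\<close>, \<open><o\<close> and \<open>=o\<close>.
\<close>

fun tau :: "'v::zf component \<Rightarrow> 'v rel" where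
  "tau (Zermelo Y) = |elts Y|"
| "tau (NonZermelo m Y) = |elts Y|"

definition well_represented :: "'v::zf component list \<Rightarrow> bool" where
  "well_represented Cs \<longleftrightarrow>
     (\<forall>i j. i \<le> j \<longrightarrow> j < length Cs \<longrightarrow> rho (Cs ! i) \<ge> rho (Cs ! j)) \<and>
     (\<forall>i k. i + k < length Cs \<longrightarrow> (\<forall>l\<le>k. rho (Cs ! (i + l)) = rho (Cs ! i)) \<longrightarrow>
        (\<forall>l l'. l \<le> l' \<longrightarrow> l' \<le> k \<longrightarrow> tau (Cs ! (i + l')) \<le>o tau (Cs ! (i + l))))"

text \<open>
  \<open>representation X X\<^sub>1 Cs\<close>: the form \<open>X\<close> is the union of the Zermelo set \<open>X\<^sub>1\<close> and of the members
  \<open>X\<^sub>2, X\<^sub>3, \<dots>\<close> of \<open>Cs\<close>, of which \<open>Cs ! 0\<close> is \<open>X\<^sub>2\<close>. Non-empty means different from the empty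
  set; every non-Zermelo set is non-empty in this sense.
\<close>

definition representation :: "'v::zf union_form \<Rightarrow> 'v \<Rightarrow> 'v component list \<Rightarrow> bool" where
  "representation X X\<^sub>1 Cs \<longleftrightarrow>
     X = single (Zermelo X\<^sub>1) \<squnion>\<^sub>E Union_list Cs \<and>
     (\<forall>C\<in>set Cs. is_nonzermelo C \<and> C \<noteq> Zermelo zempty) \<and>
     well_represented Cs"

definition nch_le :: "'v::zf union_form \<Rightarrow> 'v union_form \<Rightarrow> bool" where
  "nch_le X Y \<longleftrightarrow> (\<exists>X\<^sub>1 Cs Y\<^sub>1 Ds. representation X X\<^sub>1 Cs \<and> representation Y Y\<^sub>1 Ds \<and>
     ( |elts X\<^sub>1| <o |elts Y\<^sub>1| \<or>
       |elts X\<^sub>1| =o |elts Y\<^sub>1| \<and> length Cs \<le> length Ds \<and>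
       (\<forall>i<length Cs. rho (Cs ! i) \<le> rho (Ds ! i) \<and> tau (Cs ! i) \<le>o tau (Ds ! i))))"

definition nch_eq :: "'v::zf union_form \<Rightarrow> 'v union_form \<Rightarrow> bool" where
  "nch_eq X Y \<longleftrightarrow> (\<exists>X\<^sub>1 Cs Y\<^sub>1 Ds. representation X X\<^sub>1 Cs \<and> representation Y Y\<^sub>1 Ds \<and>
     |elts X\<^sub>1| =o |elts Y\<^sub>1| \<and> length Cs = length Ds \<and>
     rho (Zermelo X\<^sub>1) = rho (Zermelo Y\<^sub>1) \<and> tau (Zermelo X\<^sub>1) =o tau (Zermelo Y\<^sub>1) \<and>
     (\<forall>i<length Cs. rho (Cs ! i) = rho (Ds ! i) \<and> tau (Cs ! i) =o tau (Ds ! i)))"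

definition nch_less :: "'v::zf union_form \<Rightarrow> 'v union_form \<Rightarrow> bool" where
  "nch_less X Y \<longleftrightarrow> nch_le X Y \<and> \<not> nch_eq X Y"


text \<open>
  Every element of \<open>EZF_star\<close> has a representation, and any two have the same Zermelo part and the
  same sequences of values of \<open>rho\<close> and \<open>tau\<close>. So the existential quantifiers over
  representations in \<open>nch_le\<close> and \<open>nch_eq\<close> involve no choice.
\<close>

definition below :: "'v::zf component \<Rightarrow> 'v component \<Rightarrow> bool" where
  "below C D \<longleftrightarrow> rho D < rho C \<or> rho D = rho C \<and> tau D \<le>o tau C"

lemma tau_card_order: "\<exists>A. tau C = |A|"
  by (cases C) auto

lemma below_refl: "below C C"
  using tau_card_order[of C] by (auto simp: below_def card_of_refl ordIso_imp_ordLeq)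

lemma below_trans: "below C D \<Longrightarrow> below D E \<Longrightarrow> below C E"
  by (auto simp: below_def intro: ordLeq_transitive)

lemma below_total: "below C D \<or> below D C"
proof -
  obtain A B where "tau C = |A|" "tau D = |B|"
    using tau_card_order by metis
  then have "tau C \<le>o tau D \<or> tau D \<le>o tau C"
    using ordLeq_total[of "|A|" "|B|"] by (simp add: card_of_Well_order)
  then show ?thesis
    by (auto simp: below_def)
qed

lemma well_represented_iff:
  "well_represented Cs \<longleftrightarrow> sorted_wrt below Cs"
proof
  assume L: "well_represented Cs"
  show "sorted_wrt below Cs"
    unfolding sorted_wrt_iff_nth_less
  proof (intro allI impI)
    fix i j assume ij: "i < j" "j < length Cs"
    have mono: "\<And>i j. i \<le> j \<Longrightarrow> j < length Cs \<Longrightarrow> rho (Cs ! i) \<ge> rho (Cs ! j)"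
      using L by (simp add: well_represented_def)
    show "below (Cs ! i) (Cs ! j)"
    proof (cases "rho (Cs ! j) = rho (Cs ! i)")
      case True
      have "rho (Cs ! (i + l)) = rho (Cs ! i)" if "l \<le> j - i" for l
      proof (rule antisym)
        show "rho (Cs ! (i + l)) \<le> rho (Cs ! i)"
          using that ij by (intro mono) auto
        have "rho (Cs ! j) \<le> rho (Cs ! (i + l))"
          using that ij by (intro mono) auto
        then show "rho (Cs ! i) \<le> rho (Cs ! (i + l))" using True by simp
      qed
      moreover have "i + (j - i) < length Cs" using ij by simp
      ultimately have "tau (Cs ! (i + (j - i))) \<le>o tau (Cs ! (i + 0))"
        using L unfolding well_represented_def by blast
      then show ?thesis using ij True by (simp add: below_def)
    next
      case False
      then show ?thesis using mono[of i j] ij by (simp add: below_def)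
    qed
  qed
next
  assume R: "sorted_wrt below Cs"
  have b: "below (Cs ! i) (Cs ! j)" if "i \<le> j" "j < length Cs" for i j
    using R that below_refl by (cases "i = j") (auto simp: sorted_wrt_iff_nth_less)
  show "well_represented Cs"
    unfolding well_represented_def
  proof (intro conjI allI impI)
    fix i j assume "i \<le> j" "j < length Cs"
    then show "rho (Cs ! i) \<ge> rho (Cs ! j)"
      using b[of i j] by (auto simp: below_def)
  next
    fix i k l l'
    assume "i + k < length Cs" "\<forall>l\<le>k. rho (Cs ! (i + l)) = rho (Cs ! i)" "l \<le> l'" "l' \<le> k"
    then show "tau (Cs ! (i + l')) \<le>o tau (Cs ! (i + l))"
      using b[of "i + l" "i + l'"] by (auto simp: below_def)
  qed
qed

lemma Union_list_nonzermelo: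
  "\<forall>C\<in>set Cs. is_nonzermelo C \<Longrightarrow> Union_list Cs = Union_Form zempty (mset Cs)"
  by (induction Cs) (auto simp: Union_list_def is_nonzermelo_iff)

lemma representation_iff:
  "representation (Union_Form Z M) X\<^sub>1 Cs \<longleftrightarrow>
     X\<^sub>1 = Z \<and> mset Cs = M \<and> (\<forall>C\<in>set Cs. is_nonzermelo C) \<and> sorted_wrt below Cs"
  by (auto simp: representation_def well_represented_iff Union_list_nonzermelo is_nonzermelo_iff)

lemma exists_sorted_below: "\<exists>Cs. mset Cs = M \<and> sorted_wrt below Cs"
proof (induction M)
  case (add C M)
  then obtain Cs where Cs: "mset Cs = M" "sorted_wrt below Cs" by blast
  let ?Ds = "filter (\<lambda>D. \<not> below C D) Cs @ C # filter (below C) Cs"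
  have "mset ?Ds = add_mset C M"
    using Cs(1) multiset_partition[of M "below C"] by (simp add: add.commute)
  moreover have "sorted_wrt below ?Ds"
    using Cs(2) below_total below_trans
    by (auto simp: sorted_wrt_append sorted_wrt_filter) blast+
  ultimately show ?case by blast
qed simp

lemma EZF_star_representation:
  assumes "X \<in> EZF_star"
  shows "\<exists>X\<^sub>1 Cs. representation X X\<^sub>1 Cs"
proof -
  have "\<exists>Z M. X = Union_Form Z M \<and> (\<forall>C\<in>#M. is_nonzermelo C)"
    using assms
  proof induction
    case (union X Y)
    then show ?case by fastforce
  qed (auto simp: is_zermelo_def is_nonzermelo_iff)
  then obtain Z M where X: "X = Union_Form Z M" "\<forall>C\<in>#M. is_nonzermelo C" by blast
  obtain Cs where "mset Cs = M" "sorted_wrt below Cs"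
    using exists_sorted_below by blast
  with X have "representation X Z Cs"
    by (auto simp: representation_iff)
  then show ?thesis by blast
qed

lemma sorted_below_nth:
  assumes "mset Cs = mset Ds" "sorted_wrt below Cs" "sorted_wrt below Ds" "i < length Cs"
  shows "below (Cs ! i) (Ds ! i)"
proof (rule ccontr)
  assume n: "\<not> below (Cs ! i) (Ds ! i)"
  have len: "length Cs = length Ds" using assms(1) by (metis size_mset)
  let ?P = "\<lambda>C. below C (Ds ! i)"
  have 1: "?P C" if C: "C \<in> set (take (Suc i) Ds)" for C
  proof -
    obtain j where j: "j < length (take (Suc i) Ds)" "C = take (Suc i) Ds ! j"
      using C unfolding in_set_conv_nth by blast
    then have "C = Ds ! j" "j = i \<or> j < i" by auto
    moreover have "below (Ds ! j) (Ds ! i)" if "j < i"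
      using assms(3,4) len that by (simp add: sorted_wrt_iff_nth_less)
    ultimately show ?thesis using below_refl by blast
  qed
  have f1: "filter ?P (take (Suc i) Ds) = take (Suc i) Ds"
    by (rule filter_True) (use 1 in blast)
  have "Suc i = length (filter ?P (take (Suc i) Ds))"
    unfolding f1 using assms(4) len by simp
  also have "\<dots> \<le> length (filter ?P (take (Suc i) Ds @ drop (Suc i) Ds))"
    by (simp only: filter_append length_append le_add1)
  finally have 2: "Suc i \<le> length (filter ?P Ds)"
    by (simp only: append_take_drop_id)
  have 3: "\<not> ?P C" if C: "C \<in> set (drop i Cs)" for C
  proof -
    obtain j where "j < length (drop i Cs)" "C = drop i Cs ! j"
      using C unfolding in_set_conv_nth by blast
    then have j: "C = Cs ! (i + j)" "i + j < length Cs" by auto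
    have "below (Cs ! i) C"
    proof (cases "j = 0")
      case False
      then have "i < i + j" by simp
      then show ?thesis
        using assms(2) j unfolding sorted_wrt_iff_nth_less by blast
    qed (simp add: j below_refl)
    then show ?thesis using n below_trans by blast
  qed
  have f3: "filter ?P (drop i Cs) = []"
    by (rule filter_False) (use 3 in blast)
  have "length (filter ?P Cs) = length (filter ?P (take i Cs @ drop i Cs))"
    by (simp only: append_take_drop_id)
  also have "\<dots> = length (filter ?P (take i Cs))"
    unfolding filter_append f3 by simp
  also have "\<dots> \<le> i"
    by (rule order_trans[OF length_filter_le]) simp
  finally have "length (filter ?P Cs) \<le> i" .
  moreover have "length (filter ?P Cs) = length (filter ?P Ds)"
    using assms(1) by (metis mset_filter size_mset)
  ultimately show False using 2 by simp
qed

lemma representation_unique: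
  assumes "representation X X\<^sub>1 Cs" "representation X Y\<^sub>1 Ds"
  shows "X\<^sub>1 = Y\<^sub>1" "length Cs = length Ds"
    "i < length Cs \<Longrightarrow> rho (Cs ! i) = rho (Ds ! i)"
    "i < length Cs \<Longrightarrow> tau (Cs ! i) =o tau (Ds ! i)"
proof -
  obtain Z M where X: "X = Union_Form Z M" by (cases X)
  have *: "mset Cs = mset Ds" "sorted_wrt below Cs" "sorted_wrt below Ds"
    using assms by (auto simp: X representation_iff)
  show "X\<^sub>1 = Y\<^sub>1" using assms by (auto simp: X representation_iff)
  show len: "length Cs = length Ds" using * by (metis size_mset)
  assume i: "i < length Cs"
  have "below (Cs ! i) (Ds ! i)" "below (Ds ! i) (Cs ! i)"
    using sorted_below_nth * i len by metis+
  then show "rho (Cs ! i) = rho (Ds ! i)" "tau (Cs ! i) =o tau (Ds ! i)"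
    by (auto simp: below_def ordIso_iff_ordLeq)
qed

end

theory Submission
  imports Defs
begin

text \<open>The order compares Zermelo parts first and non-Zermelo parts only on a tie. Adjoining
  P^{-n}(Z') keeps the Zermelo part \<open>Z\<close> but adds one non-Zermelo part
  (\<open>nch_less_add_nonzermelo\<close>). Passing to P(Z) enlarges the Zermelo part by Cantor's
  theorem, which outweighs all non-Zermelo parts (\<open>nch_less_if_card_less\<close>). Strictness
  rests on \<open>representation_unique\<close>.\<close>

lemma separation: "A \<subseteq> elts X \<Longrightarrow> \<exists>s::'v::zf. elts s = A"
proof -
  assume A: "A \<subseteq> elts X"
  \<comment> \<open>Replacement along the identity restricted to \<open>A\<close>, a partial
    function.\<close>
  obtain s where "\<forall>y. mem y s \<longleftrightarrow> (\<exists>x. mem x X \<and> x = y \<and> y \<in> A)"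
    using replacement[of X "\<lambda>x y. x = y \<and> y \<in> A"] by blast
  with A have "elts s = A"
    by (auto simp: elts_def)
  then show ?thesis ..
qed

text \<open>Cantor's theorem in HOL concerns all HOL subsets of \<open>elts Z\<close>; by
  separation, each is the extension of a member of \<open>zpow Z\<close>.\<close>

lemma card_elts_less_zpow: "|elts Z| <o |elts (zpow Z)|"
proof -
  have "elts ` elts (zpow Z) = Pow (elts Z)"
    using separation by auto (metis Pow_iff image_eqI mem_Collect_eq)
  then have "|Pow (elts Z)| \<le>o |elts (zpow Z)|"
    using card_of_image by metis
  with card_of_Pow show ?thesis
    by (rule ordLess_ordLeq_trans)
qed

text \<open>Equality would make the Zermelo parts, which are unique, equinumerous.\<close>

lemma nch_less_if_card_less:
  assumes "representation X X\<^sub>1 Cs" "representation Y Y\<^sub>1 Ds" "|elts X\<^sub>1| <o |elts Y\<^sub>1|"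
  shows "nch_less X Y"
proof -
  have "\<not> nch_eq X Y"
    using assms representation_unique(1) not_ordLess_ordIso
    unfolding nch_eq_def by blast
  with assms show ?thesis
    unfolding nch_less_def nch_le_def by blast
qed

text \<open>Since \<open>Ds\<close> comes last, each member of \<open>Cs\<close> is compared with
  itself; the lengths rule out equality.\<close>

lemma nch_less_add_nonzermelo:
  assumes "representation X X\<^sub>1 Cs" "representation Y X\<^sub>1 (Cs @ Ds)" "Ds \<noteq> []"
  shows "nch_less X Y"
proof -
  \<comment> \<open>Reflexivity of \<open>\<le>o\<close> needs a well-order; values of
    \<open>tau\<close> are cardinals.\<close>
  have "tau C \<le>o tau C" for C :: "'a component"
    using below_refl[of C] by (auto simp: below_def)
  then have "nch_le X Y"
    unfolding nch_le_def using assms(1,2) card_of_refl[of "elts X\<^sub>1"]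
    by (intro exI[of _ X\<^sub>1] exI[of _ Cs] exI[of _ "Cs @ Ds"]) (auto simp: nth_append)
  moreover have "\<not> nch_eq X Y"
  proof
    assume "nch_eq X Y"
    then obtain X\<^sub>2 Cs' Y\<^sub>2 Ds' where "representation X X\<^sub>2 Cs'" "representation Y Y\<^sub>2 Ds'"
      "length Cs' = length Ds'"
      unfolding nch_eq_def by blast
    with assms(1,2) have "length Cs = length (Cs @ Ds)"
      using representation_unique(2) by metis
    with assms(3) show False by simp
  qed
  ultimately show ?thesis
    by (simp add: nch_less_def)
qed

theorem theorem3:
  fixes Z Z' :: "'v::zf" and n :: nat
  assumes "\<not> powered Z'"
    and "nch_less (single (Zermelo Z)) (single (Zermelo (zpow Z')))"
    and "n \<ge> 1"
  shows "nch_less (single (Zermelo Z)) (single (Zermelo Z) \<squnion>\<^sub>E single (inv_pow n Z')) \<and>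
         nch_less (single (Zermelo Z) \<squnion>\<^sub>E single (inv_pow n Z')) (single (Zermelo (zpow Z)))"
proof
  let ?N = "NonZermelo n Z'"
  have Zermelo: "representation (single (Zermelo X)) X []" for X :: 'v
    by (simp add: representation_iff)
  \<comment> \<open>As \<open>Z'\<close> is non-powered and n \<ge> 1, \<open>inv_pow n Z'\<close>
    is non-Zermelo, so the Zermelo part stays \<open>Z\<close>.\<close>
  have union: "representation (single (Zermelo Z) \<squnion>\<^sub>E single (inv_pow n Z')) Z [?N]"
    using assms(1,3) by (auto simp: inv_pow_nonpowered representation_iff is_nonzermelo_iff)
  show "nch_less (single (Zermelo Z)) (single (Zermelo Z) \<squnion>\<^sub>E single (inv_pow n Z'))"
    \<comment> \<open>Here \<open>Cs\<close> is empty.\<close>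
    using nch_less_add_nonzermelo[OF Zermelo, of _ Z "[?N]"] union by simp
  show "nch_less (single (Zermelo Z) \<squnion>\<^sub>E single (inv_pow n Z')) (single (Zermelo (zpow Z)))"
    using union Zermelo card_elts_less_zpow by (rule nch_less_if_card_less)
qed

end
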